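(* Let $(X,\tau)$ be a topological vector lattice (with $X$ an Archimedean real vector lattice and $\tau$ a Hausdorff locally solid linear topology). The following statements are equivalent. (i) $\dim X<\infty$. (ii) For every net $(x_\alpha)$ in $X$, $x_\alpha\to 0$ with respect to $\tau$ if and only if $(x_\alpha)$ is order convergent to $0$ in $X$.
   Context: A topological vector lattice is a real vector lattice $X$ with a Hausdorff linear topology $\tau$ having a base at zero of solid sets (a set $S$ is solid if $|y|\le|x|$, $x\in S$ imply $y\in S$). All vector lattices are assumed Archimedean. A net $(x_\alpha)_{\alpha\in A}$ in $X$ is order convergent to $x\in X$ if there is a net $(y_\beta)_{\beta\in B}$ in $X$ (with a possibly different index set) such that $y_\beta\downarrow 0$ (i.e. $(y_\beta)$ is decreasing with infimum $0$ in $X$) and for each $\beta\in B$ there is $\alpha_\beta\in A$ with $|x_\alpha-x|\le y_\beta$ for all $\alpha\ge\alpha_\beta$. *)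

theory Defs
  imports "HOL-Analysis.Analysis" "HOL-Library.Lattice_Algebras"
begin

text \<open>Real vector lattices; the class \<^class>\<open>lattice_ab_group_add_abs\<close> supplies
  \<open>\<bar>x\<bar> = sup x (- x)\<close>.\<close>

class vector_lattice = ordered_real_vector + lattice_ab_group_add_abs

class archimedean_vector_lattice = vector_lattice +
  assumes archimedean: "0 \<le> x \<Longrightarrow> (\<And>n::nat. real n *\<^sub>R x \<le> y) \<Longrightarrow> x = 0"

definition (in vector_lattice) solid :: "'a set \<Rightarrow> bool"
  where "solid S \<longleftrightarrow> (\<forall>x\<in>S. \<forall>y. \<bar>y\<bar> \<le> \<bar>x\<bar> \<longrightarrow> y \<in> S)"

text \<open>The solid sets of a base at zero are neighbourhoods of zero; they need not be open.\<close>

class topological_vector_lattice =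
  archimedean_vector_lattice + topological_ab_group_add + t2_space +
  assumes tendsto_scaleR_Pair:
      "LIM p (nhds c \<times>\<^sub>F nhds x). fst p *\<^sub>R snd p :> nhds (c *\<^sub>R x)"
    and solid_base:
      "open U \<Longrightarrow> 0 \<in> U \<Longrightarrow> \<exists>S\<subseteq>U. solid S \<and> eventually (\<lambda>z. z \<in> S) (nhds 0)"

text \<open>A net is a family \<open>x\<close> on an index set \<open>A\<close> directed by a preorder \<open>r\<close>
  (\<open>r a b\<close> means that \<open>b\<close> is beyond \<open>a\<close>); the values of \<open>x\<close> and \<open>r\<close> outside \<open>A\<close>
  are irrelevant.\<close>

definition directed_set :: "'i set \<Rightarrow> ('i \<Rightarrow> 'i \<Rightarrow> bool) \<Rightarrow> bool"
  where "directed_set A r \<longleftrightarrow>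
    A \<noteq> {} \<and> reflp_on A r \<and> transp_on A r \<and> (\<forall>a\<in>A. \<forall>b\<in>A. \<exists>c\<in>A. r a c \<and> r b c)"

definition tails :: "'i set \<Rightarrow> ('i \<Rightarrow> 'i \<Rightarrow> bool) \<Rightarrow> 'i filter"
  where "tails A r = (INF a\<in>A. principal {b\<in>A. r a b})"

lemma eventually_tails:
  assumes "directed_set A r"
  shows "eventually P (tails A r) \<longleftrightarrow> (\<exists>a\<in>A. \<forall>b\<in>A. r a b \<longrightarrow> P b)"
proof -
  have "eventually P (tails A r) \<longleftrightarrow> (\<exists>a\<in>A. eventually P (principal {b\<in>A. r a b}))"
    unfolding tails_def
  proof (rule eventually_INF_base)
    show "A \<noteq> {}"
      using assms by (simp add: directed_set_def)
    fix a b assume "a \<in> A" "b \<in> A"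
    with assms obtain c where c: "c \<in> A" "r a c" "r b c"
      unfolding directed_set_def by blast
    have "{d\<in>A. r c d} \<subseteq> {d\<in>A. r a d} \<inter> {d\<in>A. r b d}"
      using assms c \<open>a \<in> A\<close> \<open>b \<in> A\<close> unfolding directed_set_def by (blast dest: transp_onD)
    with c show "\<exists>c\<in>A. principal {d\<in>A. r c d} \<le>
        inf (principal {d\<in>A. r a d}) (principal {d\<in>A. r b d})"
      by auto
  qed
  then show ?thesis
    by (auto simp: eventually_principal)
qed

definition net_decreasing_to_0 ::
    "'i set \<Rightarrow> ('i \<Rightarrow> 'i \<Rightarrow> bool) \<Rightarrow> ('i \<Rightarrow> 'a::vector_lattice) \<Rightarrow> bool"
  where "net_decreasing_to_0 B s y \<longleftrightarrow>
    (\<forall>b\<in>B. \<forall>b'\<in>B. s b b' \<longrightarrow> y b' \<le> y b) \<and>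
    (\<forall>b\<in>B. 0 \<le> y b) \<and> (\<forall>z. (\<forall>b\<in>B. z \<le> y b) \<longrightarrow> z \<le> 0)"

text \<open>The dominating net has an index set of its own, but of the same type \<open>'i\<close>. A decreasing
  net can be reindexed by the set of its values, so no generality is lost whenever
  \<open>'a\<close> embeds into \<open>'i\<close>.\<close>

definition order_convergent ::
    "'i set \<Rightarrow> ('i \<Rightarrow> 'i \<Rightarrow> bool) \<Rightarrow> ('i \<Rightarrow> 'a::vector_lattice) \<Rightarrow> 'a \<Rightarrow> bool"
  where "order_convergent A r x l \<longleftrightarrow>
    (\<exists>(B::'i set) s y. directed_set B s \<and> net_decreasing_to_0 B s y \<and>
      (\<forall>b\<in>B. \<exists>a\<in>A. \<forall>c\<in>A. r a c \<longrightarrow> \<bar>x c - l\<bar> \<le> y b))"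

text \<open>HOL cannot quantify over index types inside a formula. Index sets are therefore arbitrary
  subsets of the type below. Its first summand \<open>'u\<close> is a free type variable, so index sets of any
  type are covered. Its second summand guarantees a sufficient supply of nets for every \<open>'u\<close>: the
  tail filter of any net in \<open>'a\<close> is also that of a net indexed by pairs \<open>(S, z)\<close> with \<open>S\<close>
  in the filter and \<open>z \<in> S\<close>.\<close>

type_synonym ('u, 'a) net_index = "'u + 'a set \<times> 'a"

end

theory Submission
  imports Defs
begin

text \<open>
Two translations reduce the theorem to a statement without nets and without bases.

First, both kinds of convergence to \<open>0\<close> of a net depend only on the filter that the net generates
on the space, and every proper filter is generated by a net (\<open>nets_iff_filters\<close>). For such a filter
\<open>F\<close>, order convergence to \<open>0\<close> says that the elements \<open>v\<close> with \<open>\<bar>w\<bar> \<le> v\<close> eventually along \<open>F\<close>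
have infimum \<open>0\<close>; these elements are closed under binary infima, so they are themselves the best
dominating net (\<open>order_convergent_iff_order_null\<close>).

Second, an Archimedean vector lattice is finite-dimensional iff it has no infinite set of pairwise
disjoint positive elements (\<open>finite_dimensional_iff_finite_disjoint\<close>). Disjoint positive elements
are linearly independent. Conversely, without infinite disjoint sets every positive element lies
above an atom, because otherwise it could be split again and again; a maximal disjoint set of atoms
is then a basis, and positive elements have nonnegative coordinates in it (\<open>finite_atomic_frame\<close>).

If both convergences agree, the neighbourhood filter of \<open>0\<close> is order convergent. As an order convergent
filter it is bounded, so some order interval \<open>[-e, e]\<close> is a neighbourhood of \<open>0\<close>. The members of an
infinite disjoint set can be rescaled to lie below \<open>e\<close> while their doubles do not. Their cofinite
filter is order convergent to \<open>0\<close>, since an order bounded infinite disjoint set always is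
(\<open>bounded_disjoint_order_null\<close>), but it stays outside the neighbourhood \<open>{w. \<bar>2 w\<bar> \<le> e}\<close>,
a contradiction.

If all disjoint sets are finite, let \<open>e\<close> be the sum of the atoms in the basis. Both convergences
of a filter mean that for each \<open>\<epsilon> > 0\<close> eventually \<open>\<bar>w\<bar> \<le> \<epsilon> e\<close>
(\<open>filters_agree_if_finite_disjoint\<close>), because a positive element that lies above none of the
elements \<open>\<epsilon> a\<close>, with \<open>a\<close> an atom of the basis, lies below \<open>\<epsilon> e\<close>.
\<close>

section \<open>Disjointness in vector lattices\<close>

lemma disjoint_mono:
  fixes a b :: "'a::vector_lattice"
  assumes "inf a b = 0" "0 \<le> x" "x \<le> a" "0 \<le> y" "y \<le> b"
  shows "inf x y = 0"
  using inf_mono[OF assms(3,5)] assms by (intro order_antisym) simp_all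

lemma disjoint_add:
  fixes a b c :: "'a::vector_lattice"
  assumes "0 \<le> a" "0 \<le> b" "0 \<le> c" "inf a b = 0" "inf a c = 0"
  shows "inf a (b + c) = 0"
proof -
  \<comment> \<open>Shift by \<open>c\<close> to use disjointness from \<open>b\<close>; what is left is below both \<open>a\<close> and \<open>c\<close>.\<close>
  let ?w = "inf a (b + c)"
  have "?w - c \<le> b" by (simp add: diff_le_eq)
  moreover have "?w + 0 \<le> a + c" by (rule add_mono[OF inf_le1 assms(3)])
  then have "?w - c \<le> a" by (simp only: add_0_right diff_le_eq)
  ultimately have "?w - c \<le> inf a b" by simp
  then have "?w \<le> inf a c" using assms(4) by simp
  then show ?thesis using assms by (simp add: order_antisym)
qed

lemma disjoint_scaleR:
  fixes a b :: "'a::vector_lattice"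
  assumes "0 \<le> a" "0 \<le> b" "inf a b = 0" "0 \<le> s" "0 \<le> t"
  shows "inf (s *\<^sub>R a) (t *\<^sub>R b) = 0"
proof -
  \<comment> \<open>A common bound of both scalars; the summand \<open>1\<close> makes it positive.\<close>
  define m where "m = s + t + 1"
  let ?w = "inf (s *\<^sub>R a) (t *\<^sub>R b)"
  have m: "0 < m" "s \<le> m" "t \<le> m" using assms by (auto simp: m_def)
  have "?w \<le> m *\<^sub>R a" "?w \<le> m *\<^sub>R b"
    by (rule order_trans[OF inf_le1 scaleR_right_mono[OF m(2) assms(1)]],
        rule order_trans[OF inf_le2 scaleR_right_mono[OF m(3) assms(2)]])
  moreover have eq: "(1 / m) *\<^sub>R (m *\<^sub>R v) = v" "m *\<^sub>R ((1 / m) *\<^sub>R v) = v" for v :: 'a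
    using m by auto
  moreover have "0 \<le> 1 / m" "0 \<le> m" using m by auto
  ultimately have "(1 / m) *\<^sub>R ?w \<le> a" "(1 / m) *\<^sub>R ?w \<le> b"
    by (metis scaleR_left_mono)+
  then have "(1 / m) *\<^sub>R ?w \<le> 0" unfolding assms(3)[symmetric] by (rule inf_greatest)
  from scaleR_left_mono[OF this \<open>0 \<le> m\<close>] have "?w \<le> 0" by (simp only: eq scaleR_zero_right)
  then show ?thesis
    using assms by (intro order_antisym inf_greatest) (auto intro: scaleR_nonneg_nonneg)
qed

lemma disjoint_add_le:
  fixes a b u :: "'a::vector_lattice"
  assumes "inf a b = 0" "a \<le> u" "b \<le> u"
  shows "a + b \<le> u"
proof -
  have "a + b = sup a b + inf a b" by (rule add_eq_inf_sup)
  then show ?thesis using assms by simp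
qed

lemma disjoint_sum:
  fixes a :: "'a::vector_lattice"
  assumes "finite I" "0 \<le> a" "\<And>i. i \<in> I \<Longrightarrow> 0 \<le> f i" "\<And>i. i \<in> I \<Longrightarrow> inf a (f i) = 0"
  shows "inf a (\<Sum>i\<in>I. f i) = 0"
  using assms
  by (induction I rule: finite_induct) (auto intro!: disjoint_add sum_nonneg simp: inf_absorb2)

lemma disjoint_sum_le:
  fixes u :: "'a::vector_lattice"
  assumes "finite I" "0 \<le> u" "\<And>i. i \<in> I \<Longrightarrow> 0 \<le> f i" "\<And>i. i \<in> I \<Longrightarrow> f i \<le> u"
    and "pairwise (\<lambda>i j. inf (f i) (f j) = 0) I"
  shows "(\<Sum>i\<in>I. f i) \<le> u"
  using assms
proof (induction I rule: finite_induct)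
  case (insert i I)
  have "inf (f i) (\<Sum>j\<in>I. f j) = 0"
    using insert.hyps insert.prems by (intro disjoint_sum) (auto simp: pairwise_insert)
  then show ?case
    using insert by (auto intro!: disjoint_add_le simp: pairwise_insert)
qed simp

definition disjoint_positive :: "'a::vector_lattice set \<Rightarrow> bool"
  where "disjoint_positive D \<longleftrightarrow> (\<forall>d\<in>D. 0 < d) \<and> pairwise (\<lambda>a b. inf a b = 0) D"

text \<open>In a vanishing linear combination each term is dominated in absolute value by the sum of
  the absolute values of the others. It is also disjoint from that sum, hence zero.\<close>
lemma disjoint_positive_independent:
  fixes D :: "'a::vector_lattice set"
  assumes "disjoint_positive D"
  shows "independent D"
  unfolding independent_explicit_finite_subsets
proof (intro allI impI ballI)
  fix S u a
  assume S: "S \<subseteq> D" "finite S" and zero: "(\<Sum>v\<in>S. u v *\<^sub>R v) = 0" and a: "a \<in> S"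
  have pos: "0 < v" if "v \<in> S" for v
    using assms S that by (auto simp: disjoint_positive_def)
  then have nonneg: "0 \<le> \<bar>u v\<bar> *\<^sub>R v" if "v \<in> S" for v
    using that by (simp add: scaleR_nonneg_nonneg less_imp_le)
  have disj: "inf v w = 0" if "v \<in> S" "w \<in> S" "v \<noteq> w" for v w
    using assms S(1) that unfolding disjoint_positive_def pairwise_def by blast
  have abs_le: "\<bar>t *\<^sub>R v\<bar> \<le> \<bar>t\<bar> *\<^sub>R v" if "0 \<le> v" for t and v :: 'a
    using scaleR_right_mono[OF abs_ge_self that] scaleR_right_mono[OF abs_ge_minus_self that]
    by (intro abs_leI) auto
  let ?rest = "\<Sum>v\<in>S - {a}. \<bar>u v\<bar> *\<^sub>R v"
  have "u a *\<^sub>R a = - (\<Sum>v\<in>S - {a}. u v *\<^sub>R v)"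
    using zero sum.remove[OF S(2) a, of "\<lambda>v. u v *\<^sub>R v"] by (simp add: eq_neg_iff_add_eq_0)
  then have "\<bar>u a *\<^sub>R a\<bar> \<le> (\<Sum>v\<in>S - {a}. \<bar>u v *\<^sub>R v\<bar>)"
    by (simp add: sum_abs)
  also have "\<dots> \<le> ?rest"
    using pos by (intro sum_mono abs_le) (simp add: less_imp_le)
  finally have le: "\<bar>u a *\<^sub>R a\<bar> \<le> ?rest" .
  have "inf (\<bar>u a\<bar> *\<^sub>R a) ?rest = 0"
  proof (rule disjoint_sum)
    show "inf (\<bar>u a\<bar> *\<^sub>R a) (\<bar>u v\<bar> *\<^sub>R v) = 0" if "v \<in> S - {a}" for v
      using a that pos by (intro disjoint_scaleR disj) (auto simp: less_imp_le)
  qed (use S a nonneg in auto)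
  moreover have "0 \<le> ?rest"
    using nonneg by (intro sum_nonneg) simp
  moreover have "\<bar>u a *\<^sub>R a\<bar> \<le> \<bar>u a\<bar> *\<^sub>R a"
    using pos[OF a] by (intro abs_le) (simp add: less_imp_le)
  ultimately have "\<bar>u a *\<^sub>R a\<bar> \<le> 0"
    using le_infI[OF _ le, of "\<bar>u a\<bar> *\<^sub>R a"] by simp
  then show "u a = 0"
    using pos[OF a] by auto
qed

section \<open>Archimedean vector lattices without infinite disjoint sets\<close>

lemma le_zero_if_le_small_multiples:
  fixes u z :: "'a::archimedean_vector_lattice"
  assumes "0 \<le> u" and small: "\<And>\<epsilon>. 0 < \<epsilon> \<Longrightarrow> z \<le> \<epsilon> *\<^sub>R u"
  shows "z \<le> 0"
proof -
  have "sup z 0 = 0"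
  proof (rule archimedean)
    fix n :: nat
    show "real n *\<^sub>R sup z 0 \<le> u"
    proof (cases "n = 0")
      case False
      have "sup z 0 \<le> (1 / real n) *\<^sub>R u"
        using False assms by (auto intro!: scaleR_nonneg_nonneg)
      then have "real n *\<^sub>R sup z 0 \<le> real n *\<^sub>R ((1 / real n) *\<^sub>R u)"
        by (intro scaleR_left_mono) auto
      then show ?thesis using False by simp
    qed (use assms in auto)
  qed simp
  then show ?thesis by (metis sup.cobounded1)
qed

text \<open>The Archimedean property bounds the set of scalars from above and makes its supremum
  attained. These maximal scalars serve as coordinates below.\<close>
lemma largest_multiple_below:
  fixes a x :: "'a::archimedean_vector_lattice"
  assumes "0 < a" "0 \<le> x"
  obtains t where "0 \<le> t" "t *\<^sub>R a \<le> x" "\<And>s. s *\<^sub>R a \<le> x \<Longrightarrow> s \<le> t"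
proof -
  define T where "T = {s. s *\<^sub>R a \<le> x}"
  have "0 \<in> T" using assms by (simp add: T_def)
  have down: "r \<in> T" if "s \<in> T" "r \<le> s" for r s
    using order_trans[OF scaleR_right_mono[OF that(2) less_imp_le[OF assms(1)]]] that(1)
    by (simp add: T_def)
  have "\<exists>n::nat. real n \<notin> T"
  proof (rule ccontr)
    assume "\<nexists>n::nat. real n \<notin> T"
    then have "a = 0" using assms(1) by (intro archimedean[of a x]) (auto simp: T_def less_imp_le)
    then show False using assms(1) by simp
  qed
  then obtain n :: nat where "real n \<notin> T" by blast
  then have bdd: "bdd_above T"
    using down by (meson bdd_above.I linear)
  have "Sup T *\<^sub>R a - x \<le> 0"
  proof (rule le_zero_if_le_small_multiples)
    fix \<epsilon> :: real assume "0 < \<epsilon>"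
    then obtain s where "s \<in> T" "Sup T - \<epsilon> < s"
      using less_cSupE[of "Sup T - \<epsilon>" T] \<open>0 \<in> T\<close> by (metis diff_less_eq empty_iff less_add_same_cancel1)
    then have "Sup T - \<epsilon> \<in> T" using down less_imp_le by blast
    then show "Sup T *\<^sub>R a - x \<le> \<epsilon> *\<^sub>R a"
      by (simp add: T_def algebra_simps)
  qed (use assms in simp)
  then show thesis
    using that[of "Sup T"] cSup_upper[OF _ bdd] \<open>0 \<in> T\<close> by (auto simp: T_def)
qed

text \<open>An atom is more commonly a positive element without two disjoint nonzero positive elements
  below it; in Archimedean spaces its multiples then exhaust the interval below it (lemma
  \<open>not_atom_splits\<close>). The latter property is what coordinate expansions use.\<close>
definition atom :: "'a::vector_lattice \<Rightarrow> bool"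
  where "atom a \<longleftrightarrow> 0 < a \<and> (\<forall>x. 0 \<le> x \<and> x \<le> a \<longrightarrow> (\<exists>t. x = t *\<^sub>R a))"

text \<open>If \<open>x\<close> is not a multiple of \<open>a\<close>, then \<open>x\<close> is incomparable with some \<open>s *\<^sub>R a\<close>, where
  \<open>s\<close> is slightly above the largest scalar with \<open>s *\<^sub>R a \<le> x\<close>. The positive and negative parts
  of \<open>x - s *\<^sub>R a\<close> are the two disjoint elements.\<close>
lemma not_atom_splits:
  fixes a :: "'a::archimedean_vector_lattice"
  assumes "0 < a" "\<not> atom a"
  obtains x y where "0 < x" "x \<le> a" "0 < y" "y \<le> a" "inf x y = 0"
proof -
  obtain x where x: "0 \<le> x" "x \<le> a" and nomult: "\<And>t. x \<noteq> t *\<^sub>R a"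
    using assms by (auto simp: atom_def)
  obtain t where t: "0 \<le> t" "t *\<^sub>R a \<le> x" "\<And>s. s *\<^sub>R a \<le> x \<Longrightarrow> s \<le> t"
    using largest_multiple_below[OF assms(1) x(1)] by blast
  have "\<exists>\<epsilon>>0. \<not> x - t *\<^sub>R a \<le> \<epsilon> *\<^sub>R a"
  proof (rule ccontr)
    assume "\<not> ?thesis"
    then have "x - t *\<^sub>R a \<le> 0"
      using assms(1) by (intro le_zero_if_le_small_multiples[of a]) auto
    then show False using t(2) nomult[of t] by (simp add: order_antisym)
  qed
  then obtain \<epsilon> where \<epsilon>: "0 < \<epsilon>" "\<not> x \<le> (t + \<epsilon>) *\<^sub>R a"
    by (auto simp: algebra_simps)
  define s where "s = t + \<epsilon>"
  \<comment> \<open>For \<open>1 \<le> s\<close> the bound \<open>x \<le> a\<close> would already give \<open>x \<le> s *\<^sub>R a\<close>.\<close>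
  have "\<not> 1 \<le> s"
    using \<epsilon>(2) x(2) scaleR_right_mono[of 1 s a] assms(1) by (auto simp: s_def intro: order_trans)
  then have sa: "0 \<le> s *\<^sub>R a" "s *\<^sub>R a \<le> a"
    using t(1) \<epsilon>(1) assms(1) scaleR_right_mono[of s 1 a] by (auto simp: s_def intro!: scaleR_nonneg_nonneg)
  have not_above: "\<not> s *\<^sub>R a \<le> x" using t(3)[of s] \<epsilon>(1) by (auto simp: s_def)
  have not_below: "\<not> x \<le> s *\<^sub>R a" using \<epsilon>(2) by (simp add: s_def)
  define m where "m = inf x (s *\<^sub>R a)"
  have m: "0 \<le> m" "m \<le> x" "m \<le> s *\<^sub>R a" using x sa by (simp_all add: m_def)
  then have "m \<noteq> x" "m \<noteq> s *\<^sub>R a" using not_above not_below by blast+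
  with m have "0 < x - m" "0 < s *\<^sub>R a - m" by (auto simp: order_less_le)
  moreover have "x - m \<le> a" "s *\<^sub>R a - m \<le> a"
    using add_mono[OF x(2) m(1)] add_mono[OF sa(2) m(1)] by (simp_all add: diff_le_eq)
  moreover have "inf (x - m) (s *\<^sub>R a - m) = 0"
    using add_inf_distrib_right[of x "s *\<^sub>R a" "- m", folded m_def] by simp
  ultimately show thesis using that by blast
qed

text \<open>Without atoms below \<open>u\<close> one can split off disjoint pieces forever: keep the first piece
  and split the second one again. The first pieces form an infinite disjoint set.\<close>
lemma atom_below:
  fixes u :: "'a::archimedean_vector_lattice"
  assumes fin: "\<And>D::'a set. disjoint_positive D \<Longrightarrow> finite D" and "0 < u"
  obtains a where "atom a" "a \<le> u"
proof (rule ccontr)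
  assume "\<not> thesis"
  then have no_atom: "\<And>a. a \<le> u \<Longrightarrow> \<not> atom a" using that by blast
  define P where "P p \<longleftrightarrow> 0 < fst p \<and> 0 < snd p \<and> snd p \<le> u \<and> inf (fst p) (snd p) = 0"
    for p :: "'a \<times> 'a"
  have split: "\<exists>p. P p \<and> fst p \<le> y \<and> snd p \<le> y" if "0 < y" "y \<le> u" for y
    using not_atom_splits[OF that(1) no_atom[OF that(2)]] that(2)
    by (metis P_def fst_conv order_trans snd_conv)
  obtain p where P: "\<And>n. P (p n)" and step: "\<And>n. fst (p (Suc n)) \<le> snd (p n) \<and> snd (p (Suc n)) \<le> snd (p n)"
    using dependent_nat_choice[of "\<lambda>_. P" "\<lambda>_ p q. fst q \<le> snd p \<and> snd q \<le> snd p"]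
      split \<open>0 < u\<close> by (metis P_def order_refl)
  have mono: "snd (p n) \<le> snd (p m)" if "m \<le> n" for m n
    using lift_Suc_antimono_le[of "\<lambda>n. snd (p n)", OF _ that] step by blast
  have disj: "inf (fst (p m)) (fst (p n)) = 0" if "m < n" for m n
  proof -
    obtain k where k: "n = Suc (m + k)" using less_imp_Suc_add[OF \<open>m < n\<close>] by blast
    have "fst (p n) \<le> snd (p m)"
      unfolding k using step[of "m + k"] mono[of m "m + k"] by (auto intro: order_trans)
    moreover have "0 < fst (p m)" "0 < fst (p n)" "inf (fst (p m)) (snd (p m)) = 0"
      using P[of m] P[of n] by (simp_all add: P_def)
    ultimately show ?thesis
      using disjoint_mono[of "fst (p m)" "snd (p m)" "fst (p m)" "fst (p n)"] by (simp add: less_imp_le)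
  qed
  have disj': "inf (fst (p m)) (fst (p n)) = 0" if "m \<noteq> n" for m n
    using that disj[of m n] disj[of n m] by (auto simp: inf_commute neq_iff)
  have "inj (fst \<circ> p)"
  proof (rule injI, rule ccontr)
    fix m n assume "(fst \<circ> p) m = (fst \<circ> p) n" "m \<noteq> n"
    then have "fst (p n) = 0" using disj'[of m n] by simp
    then show False using P[of n] by (simp add: P_def)
  qed
  then have "infinite (range (fst \<circ> p))" using finite_imageD by blast
  moreover have "disjoint_positive (range (fst \<circ> p))"
    unfolding disjoint_positive_def
  proof (intro conjI ballI pairwiseI)
    show "0 < d" if "d \<in> range (fst \<circ> p)" for d using that P by (auto simp: P_def)
    fix a b assume "a \<in> range (fst \<circ> p)" "b \<in> range (fst \<circ> p)" "a \<noteq> b"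
    then obtain m n where "a = fst (p m)" "b = fst (p n)" "m \<noteq> n" by auto
    then show "inf a b = 0" using disj' by simp
  qed
  ultimately show False using fin by blast
qed

lemma maximal_disjoint_atoms:
  obtains G :: "'a::vector_lattice set"
  where "disjoint_positive G" "\<And>a. a \<in> G \<Longrightarrow> atom a"
    "\<And>b. atom b \<Longrightarrow> \<exists>a\<in>G. inf a b \<noteq> 0"
proof -
  define \<A> where "\<A> = {D::'a set. disjoint_positive D \<and> Ball D atom}"
  have "\<exists>G\<in>\<A>. \<forall>D\<in>\<A>. G \<subseteq> D \<longrightarrow> D = G"
  proof (rule subset_Zorn')
    fix C assume C: "subset.chain \<A> C"
    then have "chain\<^sub>\<subseteq> C" by (auto simp: subset_chain_def chain_subset_def)
    then show "\<Union>C \<in> \<A>"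
      using C unfolding \<A>_def disjoint_positive_def
      by (auto simp: subset_chain_def intro!: pairwise_chain_Union)
  qed
  then obtain G where G: "G \<in> \<A>" and max: "\<And>D. D \<in> \<A> \<Longrightarrow> G \<subseteq> D \<Longrightarrow> D = G" by blast
  have "\<exists>a\<in>G. inf a b \<noteq> 0" if "atom b" for b
  proof (rule ccontr)
    assume "\<not> (\<exists>a\<in>G. inf a b \<noteq> 0)"
    then have disj: "\<forall>a\<in>G. inf a b = 0" by blast
    then have "insert b G \<in> \<A>"
      using G that by (auto simp: \<A>_def disjoint_positive_def pairwise_insert atom_def inf_commute)
    then have "b \<in> G" using max by blast
    then show False using disj that by (auto simp: atom_def)
  qed
  with that G show thesis by (auto simp: \<A>_def)
qed

text \<open>The coordinate of \<open>x\<close> at an atom \<open>a\<close> is the largest \<open>t\<close> with \<open>t *\<^sub>R a \<le> x\<close>. If the resulting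
  sum were strictly below \<open>x\<close>, some atom would lie below the difference. By maximality it meets an
  atom of the set, so a positive multiple of the latter fits under the difference as well, and
  that coordinate could be increased.\<close>
lemma finite_atomic_frame:
  assumes fin: "\<And>D::'a::archimedean_vector_lattice set. disjoint_positive D \<Longrightarrow> finite D"
  obtains G :: "'a::archimedean_vector_lattice set" where "finite G" "disjoint_positive G"
    "\<And>x. 0 \<le> x \<Longrightarrow> \<exists>t. (\<forall>a\<in>G. 0 \<le> t a) \<and> x = (\<Sum>a\<in>G. t a *\<^sub>R a)"
proof -
  obtain G :: "'a set" where disj: "disjoint_positive G" and atom: "\<And>a. a \<in> G \<Longrightarrow> atom a"
    and max: "\<And>b. atom b \<Longrightarrow> \<exists>a\<in>G. inf a b \<noteq> 0"
    using maximal_disjoint_atoms by blast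
  have finG: "finite G" using fin disj by blast
  have pos: "0 < a" if "a \<in> G" for a using atom[OF that] by (simp add: atom_def)
  have disj_atoms: "inf a b = 0" if "a \<in> G" "b \<in> G" "a \<noteq> b" for a b
    using disj that by (simp add: disjoint_positive_def pairwise_def)
  have "\<exists>t. (\<forall>a\<in>G. 0 \<le> t a) \<and> x = (\<Sum>a\<in>G. t a *\<^sub>R a)" if x: "0 \<le> x" for x
  proof -
    have "\<forall>a\<in>G. \<exists>t. 0 \<le> t \<and> t *\<^sub>R a \<le> x \<and> (\<forall>s. s *\<^sub>R a \<le> x \<longrightarrow> s \<le> t)"
      using largest_multiple_below[OF pos x] by metis
    then obtain t where t: "\<And>a. a \<in> G \<Longrightarrow> 0 \<le> t a" "\<And>a. a \<in> G \<Longrightarrow> t a *\<^sub>R a \<le> x"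
      and largest: "\<And>a s. a \<in> G \<Longrightarrow> s *\<^sub>R a \<le> x \<Longrightarrow> s \<le> t a" by metis
    let ?p = "\<Sum>a\<in>G. t a *\<^sub>R a"
    have nonneg: "0 \<le> t a *\<^sub>R a" if "a \<in> G" for a
      using that t(1) pos by (simp add: scaleR_nonneg_nonneg less_imp_le)
    have "?p \<le> x"
    proof (rule disjoint_sum_le)
      show "pairwise (\<lambda>a b. inf (t a *\<^sub>R a) (t b *\<^sub>R b) = 0) G"
        using t(1) pos by (intro pairwiseI disjoint_scaleR disj_atoms) (auto simp: less_imp_le)
    qed (use finG x t(2) nonneg in auto)
    moreover have "\<not> 0 < x - ?p"
    proof
      assume "0 < x - ?p"
      then obtain b where b: "atom b" "b \<le> x - ?p" using atom_below[OF fin] by blast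
      obtain a where a: "a \<in> G" "inf a b \<noteq> 0" using max[OF b(1)] by blast
      have nn: "0 \<le> inf a b" using pos[OF a(1)] b(1) by (simp add: atom_def less_imp_le)
      then obtain c where c: "inf a b = c *\<^sub>R a"
        using atom[OF a(1)] inf_le1 unfolding atom_def by blast
      have "0 < c"
      proof (rule ccontr)
        assume "\<not> 0 < c"
        then have "c *\<^sub>R a \<le> 0"
          using scaleR_right_mono[of c 0 a] pos[OF a(1)] by auto
        then show False using nn a(2) c by (auto intro: order_antisym)
      qed
      have "t a *\<^sub>R a \<le> ?p"
        using finG nonneg a(1) sum_mono2[of G "{a}" "\<lambda>a. t a *\<^sub>R a"] by simp
      moreover have "c *\<^sub>R a \<le> x - ?p" using b(2) c by (metis inf_le2 order_trans)
      ultimately have "t a *\<^sub>R a + c *\<^sub>R a \<le> ?p + (x - ?p)" by (rule add_mono)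
      then have "(t a + c) *\<^sub>R a \<le> x" by (simp add: scaleR_add_left)
      then show False using largest[OF a(1)] \<open>0 < c\<close> by fastforce
    qed
    ultimately show ?thesis using t(1) by (auto simp: order_less_le)
  qed
  then show thesis using that finG disj by blast
qed

lemma finite_dimensional_iff_finite_disjoint:
  "(\<exists>B::'a::archimedean_vector_lattice set. finite B \<and> independent B \<and> span B = UNIV) \<longleftrightarrow>
    (\<forall>D::'a set. disjoint_positive D \<longrightarrow> finite D)"
proof
  assume "\<exists>B::'a set. finite B \<and> independent B \<and> span B = UNIV"
  then obtain B :: "'a set" where "finite B" "span B = UNIV" by blast
  then show "\<forall>D::'a set. disjoint_positive D \<longrightarrow> finite D"
    using independent_span_bound disjoint_positive_independent by (metis subset_UNIV)
next
  assume "\<forall>D::'a set. disjoint_positive D \<longrightarrow> finite D"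
  then obtain G :: "'a set" where G: "finite G" "disjoint_positive G"
    and expand: "\<And>x. 0 \<le> x \<Longrightarrow> \<exists>t. (\<forall>a\<in>G. 0 \<le> t a) \<and> x = (\<Sum>a\<in>G. t a *\<^sub>R a)"
    using finite_atomic_frame by blast
  have nonneg: "x \<in> span G" if x: "0 \<le> x" for x
  proof -
    obtain t where "x = (\<Sum>a\<in>G. t a *\<^sub>R a)" using expand[OF x] by blast
    then show ?thesis by (simp add: span_sum span_scale span_base)
  qed
  have "x \<in> span G" for x
    using span_diff[OF nonneg[of "pprt x"] nonneg[of "- nprt x"]] prts[of x] by simp
  then show "\<exists>B::'a set. finite B \<and> independent B \<and> span B = UNIV"
    using G disjoint_positive_independent by blast
qed

section \<open>Order convergence of filters\<close>

text \<open>Order convergence to \<open>0\<close> of the identity along a filter. For a proper filter the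
  eventual bounds of \<open>\<bar>w\<bar>\<close> are nonnegative, so the condition makes \<open>0\<close> their infimum. Taking all
  of them avoids the choice of a decreasing net.\<close>
definition order_null :: "'a::vector_lattice filter \<Rightarrow> bool"
  where "order_null F \<longleftrightarrow> (\<forall>z. (\<forall>v. (\<forall>\<^sub>F w in F. \<bar>w\<bar> \<le> v) \<longrightarrow> z \<le> v) \<longrightarrow> z \<le> 0)"

text \<open>Without any eventual bound the defining condition would make every element \<open>\<le> 0\<close>, and then
  \<open>0\<close> would be such a bound.\<close>
lemma order_null_bounded:
  assumes "order_null F"
  shows "\<exists>v. \<forall>\<^sub>F w in F. \<bar>w\<bar> \<le> v"
proof (rule ccontr)
  assume none: "\<nexists>v. \<forall>\<^sub>F w in F. \<bar>w\<bar> \<le> v"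
  then have "z \<le> 0" for z :: 'a
    using assms[unfolded order_null_def, rule_format, of z] by blast
  then have "\<forall>\<^sub>F w in F. \<bar>w\<bar> \<le> 0" by simp
  with none show False by blast
qed

text \<open>The set of eventual bounds is closed under binary infima, so that, indexed by itself in the
  reverse order, it is a decreasing net.\<close>
lemma order_convergent_iff_order_null:
  fixes A :: "('u, 'a::vector_lattice) net_index set" and x :: "('u, 'a) net_index \<Rightarrow> 'a"
  assumes A: "directed_set A r"
  shows "order_convergent A r x 0 \<longleftrightarrow> order_null (filtermap x (tails A r))"
proof
  assume "order_convergent A r x 0"
  then show "order_null (filtermap x (tails A r))"
    by (fastforce simp: order_convergent_def order_null_def net_decreasing_to_0_def
        eventually_filtermap eventually_tails[OF A])
next
  assume null: "order_null (filtermap x (tails A r))"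
  define V where "V = {v. \<forall>\<^sub>F c in tails A r. \<bar>x c\<bar> \<le> v}"
  define B :: "('u, 'a) net_index set" where "B = (\<lambda>v. Inr ({}, v)) ` V"
  define y :: "('u, 'a) net_index \<Rightarrow> 'a" where "y i = snd (projr i)" for i
  have yB: "y ` B = V" by (auto simp: y_def B_def image_image)
  have "V \<noteq> {}"
    using order_null_bounded[OF null] by (auto simp: V_def eventually_filtermap)
  moreover have "inf v w \<in> V" if "v \<in> V" "w \<in> V" for v w
    using that by (simp add: V_def eventually_conj_iff)
  ultimately have dir: "directed_set B (\<lambda>i j. y j \<le> y i)"
    unfolding directed_set_def
    by (auto simp: B_def y_def reflp_on_def transp_on_def intro: order_trans inf_le1 inf_le2
        intro!: bexI[where x = "inf _ _"])
  have nonneg: "0 \<le> v" if v: "v \<in> V" for v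
  proof -
    obtain a where a: "a \<in> A" "\<And>c. c \<in> A \<Longrightarrow> r a c \<Longrightarrow> \<bar>x c\<bar> \<le> v"
      using v by (auto simp: V_def eventually_tails[OF A])
    then have "\<bar>x a\<bar> \<le> v" using A by (auto simp: directed_set_def reflp_on_def)
    then show ?thesis using abs_ge_zero order_trans by blast
  qed
  have lower: "z \<le> 0" if "\<forall>v\<in>V. z \<le> v" for z
    using null that by (simp add: order_null_def V_def eventually_filtermap)
  have "net_decreasing_to_0 B (\<lambda>i j. y j \<le> y i) y"
    unfolding net_decreasing_to_0_def
  proof (intro conjI ballI allI impI)
    show "0 \<le> y b" if "b \<in> B" for b
      using nonneg[of "y b"] yB that by blast
    show "z \<le> 0" if z: "\<forall>b\<in>B. z \<le> y b" for z
    proof (rule lower)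
      show "\<forall>v\<in>V. z \<le> v" unfolding yB[symmetric] using z by simp
    qed
  qed
  moreover have "\<forall>b\<in>B. \<exists>a\<in>A. \<forall>c\<in>A. r a c \<longrightarrow> \<bar>x c - 0\<bar> \<le> y b"
  proof
    fix b assume "b \<in> B"
    then have "y b \<in> V" using yB by blast
    then show "\<exists>a\<in>A. \<forall>c\<in>A. r a c \<longrightarrow> \<bar>x c - 0\<bar> \<le> y b"
      by (simp add: V_def eventually_tails[OF A])
  qed
  ultimately show "order_convergent A r x 0"
    using dir unfolding order_convergent_def by blast
qed

lemma directed_set_tails_neq_bot:
  assumes "directed_set A r"
  shows "tails A r \<noteq> bot"
  using assms
  by (auto simp: trivial_limit_def eventually_tails directed_set_def reflp_on_def)

text \<open>The canonical net of a filter consists of the pairs of a set of the filter and a point of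
  this set, ordered by reverse inclusion of the sets; the value at a pair is its point.\<close>
lemma filter_is_net_filter:
  fixes F :: "'a filter"
  assumes "F \<noteq> bot"
  obtains A :: "('u, 'a) net_index set" and r x
  where "directed_set A r" "filtermap x (tails A r) = F"
proof -
  define A :: "('u, 'a) net_index set"
    where "A = {Inr (S, z) | S z. (\<forall>\<^sub>F w in F. w \<in> S) \<and> z \<in> S}"
  define r :: "('u, 'a) net_index \<Rightarrow> ('u, 'a) net_index \<Rightarrow> bool"
    where "r i j \<longleftrightarrow> fst (projr j) \<subseteq> fst (projr i)" for i j
  define x :: "('u, 'a) net_index \<Rightarrow> 'a" where "x i = snd (projr i)" for i
  have inhab: "\<exists>z. z \<in> S" if "\<forall>\<^sub>F w in F. w \<in> S" for S
    using that assms eventually_happens' by blast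
  have A_iff: "Inr (S, z) \<in> A \<longleftrightarrow> (\<forall>\<^sub>F w in F. w \<in> S) \<and> z \<in> S" for S z
    by (auto simp: A_def)
  have dir: "directed_set A r"
    unfolding directed_set_def
  proof (intro conjI ballI)
    show "A \<noteq> {}" using A_iff[of UNIV undefined] by auto
    show "reflp_on A r" "transp_on A r" by (auto simp: reflp_on_def transp_on_def r_def)
    fix i j assume "i \<in> A" "j \<in> A"
    then obtain S T z w where ij: "i = Inr (S, z)" "j = Inr (T, w)"
      and S: "\<forall>\<^sub>F w in F. w \<in> S" and T: "\<forall>\<^sub>F w in F. w \<in> T"
      by (auto simp: A_def)
    then have ST: "\<forall>\<^sub>F w in F. w \<in> S \<inter> T" by (simp add: eventually_conj_iff)
    then obtain v where "v \<in> S \<inter> T" using inhab by blast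
    with ST show "\<exists>k\<in>A. r i k \<and> r j k"
      by (intro bexI[of _ "Inr (S \<inter> T, v)"]) (auto simp: A_iff r_def ij)
  qed
  have "eventually P (filtermap x (tails A r)) \<longleftrightarrow> eventually P F" for P
  proof
    assume "eventually P (filtermap x (tails A r))"
    then obtain i where i: "i \<in> A" "\<And>j. j \<in> A \<Longrightarrow> r i j \<Longrightarrow> P (x j)"
      by (auto simp: eventually_filtermap eventually_tails[OF dir])
    then obtain S z where S: "\<forall>\<^sub>F w in F. w \<in> S" and i_eq: "i = Inr (S, z)"
      by (auto simp: A_def)
    have "P w" if "w \<in> S" for w
      using i(2)[of "Inr (S, w)"] S that by (simp add: A_iff r_def x_def i_eq)
    with S show "eventually P F" by (auto elim: eventually_mono)
  next
    assume P: "eventually P F"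
    then obtain z where "P z" using inhab[of "Collect P"] by auto
    with P show "eventually P (filtermap x (tails A r))"
      unfolding eventually_filtermap eventually_tails[OF dir]
      by (intro bexI[of _ "Inr (Collect P, z)"]) (auto simp: A_def r_def x_def)
  qed
  then have "filtermap x (tails A r) = F" by (simp add: filter_eq_iff)
  with dir that show thesis by blast
qed

lemma nets_iff_filters:
  "(\<forall>(A::('u, 'a::topological_vector_lattice) net_index set) r (x::('u, 'a) net_index \<Rightarrow> 'a).
      directed_set A r \<longrightarrow> ((x \<longlongrightarrow> 0) (tails A r) \<longleftrightarrow> order_convergent A r x 0)) \<longleftrightarrow>
    (\<forall>F::'a filter. F \<noteq> bot \<longrightarrow> (F \<le> nhds 0 \<longleftrightarrow> order_null F))" (is "?nets \<longleftrightarrow> ?filters")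
proof
  assume nets: ?nets
  show ?filters
  proof (intro allI impI)
    fix F :: "'a filter" assume "F \<noteq> bot"
    then obtain A :: "('u, 'a) net_index set" and r x
      where "directed_set A r" "filtermap x (tails A r) = F"
      by (rule filter_is_net_filter)
    with nets show "F \<le> nhds 0 \<longleftrightarrow> order_null F"
      by (metis filterlim_def order_convergent_iff_order_null)
  qed
next
  assume filters: ?filters
  show ?nets
    using filters
    by (simp add: filterlim_def order_convergent_iff_order_null directed_set_tails_neq_bot filtermap_bot_iff)
qed

section \<open>Disjoint sets as null filters\<close>

text \<open>Let \<open>w \<ge> 0\<close> lie below all eventual bounds. If \<open>u\<close> is an upper bound of \<open>D\<close>, then for
  \<open>c \<in> D\<close> disjointness makes \<open>u - c\<close> an upper bound of \<open>D - {c}\<close>, hence an eventual bound, so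
  \<open>w \<le> u - c\<close>. Thus \<open>u - w\<close> is again an upper bound of \<open>D\<close>. Repeating this from \<open>u = e\<close> shows
  \<open>real n *\<^sub>R w \<le> e\<close> for all \<open>n\<close>, and \<open>w = 0\<close> by the Archimedean property.\<close>
lemma bounded_disjoint_order_null:
  fixes D :: "'a::archimedean_vector_lattice set"
  assumes D: "disjoint_positive D" "infinite D" and bound: "\<And>d. d \<in> D \<Longrightarrow> d \<le> e"
  shows "order_null (inf cofinite (principal D))"
  unfolding order_null_def
proof (intro allI impI)
  let ?F = "inf cofinite (principal D)"
  fix z assume z: "\<forall>v. (\<forall>\<^sub>F w in ?F. \<bar>w\<bar> \<le> v) \<longrightarrow> z \<le> v"
  have ev: "eventually P ?F \<longleftrightarrow> finite {d\<in>D. \<not> P d}" for P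
    by (simp add: eventually_inf_principal eventually_cofinite)
  have pos: "0 < d" if "d \<in> D" for d using D that by (simp add: disjoint_positive_def)
  define w where "w = sup z 0"
  have w: "w \<le> v" if "\<forall>d\<in>D - {c}. d \<le> v" for c v
  proof -
    have "{d\<in>D. \<not> \<bar>d\<bar> \<le> v} \<subseteq> {c}" using that pos by (auto simp: less_imp_le)
    then have "z \<le> v" using z ev by (meson finite.emptyI finite.insertI finite_subset)
    moreover obtain d where "d \<in> D - {c}" using D(2) by (metis ex_in_conv finite.emptyI finite_Diff_insert Diff_empty)
    then have "0 \<le> v" using that pos by (meson DiffD1 less_imp_le order_trans)
    ultimately show ?thesis by (simp add: w_def)
  qed
  have shift: "\<forall>d\<in>D. d \<le> u - w" if u: "\<forall>d\<in>D. d \<le> u" for u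
  proof
    fix c assume c: "c \<in> D"
    have "d + c \<le> u" if "d \<in> D - {c}" for d
      using D(1) c u that by (intro disjoint_add_le) (auto simp: disjoint_positive_def pairwise_def)
    then have "w \<le> u - c" by (intro w[of c]) (simp add: le_diff_eq)
    then show "c \<le> u - w" by (simp add: algebra_simps)
  qed
  have below: "\<forall>d\<in>D. d \<le> e - real n *\<^sub>R w" for n
  proof (induction n)
    case (Suc n)
    then show ?case using shift[OF Suc.IH] by (simp add: algebra_simps)
  qed (use bound in simp)
  have "w = 0"
  proof (rule archimedean)
    fix n :: nat
    obtain d where "d \<in> D" using D(2) by (metis ex_in_conv finite.emptyI)
    then have "0 \<le> e - real n *\<^sub>R w" using below pos by (meson less_imp_le order_trans)
    then show "real n *\<^sub>R w \<le> e" by simp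
  qed (simp add: w_def)
  then show "z \<le> 0" by (metis sup.cobounded1 w_def)
qed

lemma tendsto_scaleR_at_right_0:
  fixes e :: "'a::topological_vector_lattice"
  shows "((\<lambda>t. t *\<^sub>R e) \<longlongrightarrow> 0) (at_right 0)"
proof -
  have "filterlim (\<lambda>t. (t, e)) (nhds 0 \<times>\<^sub>F nhds e) (at_right (0::real))"
    by (intro filterlim_Pair tendsto_const tendsto_ident_at)
  from filterlim_compose[OF tendsto_scaleR_Pair this] show ?thesis by simp
qed

lemma small_multiple:
  fixes e :: "'a::topological_vector_lattice"
  assumes "eventually P (nhds 0)"
  obtains \<epsilon> where "0 < \<epsilon>" "P (\<epsilon> *\<^sub>R e)"
proof -
  have "\<forall>\<^sub>F t in at_right 0. P (t *\<^sub>R e)"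
    using tendsto_scaleR_at_right_0 assms by (auto simp: filterlim_iff)
  then have "\<forall>\<^sub>F t in at_right (0::real). 0 < t \<and> P (t *\<^sub>R e)"
    using eventually_at_right_less[of "0::real"] by eventually_elim auto
  from eventually_happens'[OF trivial_limit_at_right_real this] that show thesis by blast
qed

text \<open>The order unit \<open>e\<close> comes from order convergence of the neighbourhood filter of \<open>0\<close>. The scalar
  \<open>c d\<close> is the largest one with \<open>c d *\<^sub>R d \<le> e\<close>; it is positive because \<open>[-e, e]\<close> is a
  neighbourhood of \<open>0\<close>, and maximality keeps the doubled elements from lying below \<open>e\<close>.\<close>
lemma finite_disjoint_if_filters_agree:
  fixes D :: "'a::topological_vector_lattice set"
  assumes agree: "\<And>F::'a filter. F \<noteq> bot \<Longrightarrow> F \<le> nhds 0 \<longleftrightarrow> order_null F"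
    and D: "disjoint_positive D"
  shows "finite D"
proof (rule ccontr)
  assume "infinite D"
  have "order_null (nhds (0::'a))" using agree[of "nhds 0"] by simp
  then obtain e :: 'a where e: "\<forall>\<^sub>F w in nhds 0. \<bar>w\<bar> \<le> e" using order_null_bounded by blast
  have "0 \<le> e" using eventually_nhds_x_imp_x[OF e] by simp
  have pos: "0 < d" if "d \<in> D" for d using D that by (simp add: disjoint_positive_def)
  have "\<exists>c>0. c *\<^sub>R d \<le> e \<and> \<not> c *\<^sub>R d + c *\<^sub>R d \<le> e" if d: "d \<in> D" for d
  proof -
    obtain t where t: "t *\<^sub>R d \<le> e" "\<And>s. s *\<^sub>R d \<le> e \<Longrightarrow> s \<le> t"
      using largest_multiple_below[OF pos[OF d] \<open>0 \<le> e\<close>] by blast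
    obtain \<epsilon> where "0 < \<epsilon>" "\<bar>\<epsilon> *\<^sub>R d\<bar> \<le> e" using small_multiple[OF e] by blast
    then have "0 < t" using t(2)[of \<epsilon>] abs_ge_self order_trans by fastforce
    moreover have "\<not> t *\<^sub>R d + t *\<^sub>R d \<le> e"
      using t(2)[of "t + t"] \<open>0 < t\<close> unfolding scaleR_add_left by fastforce
    ultimately show ?thesis using t(1) by blast
  qed
  then obtain c where c: "\<And>d. d \<in> D \<Longrightarrow> 0 < c d" "\<And>d. d \<in> D \<Longrightarrow> c d *\<^sub>R d \<le> e"
    "\<And>d. d \<in> D \<Longrightarrow> \<not> c d *\<^sub>R d + c d *\<^sub>R d \<le> e" by metis
  define f where "f d = c d *\<^sub>R d" for d
  have fpos: "0 < f d" if "d \<in> D" for d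
    using c(1)[OF that] pos[OF that] by (simp add: f_def order_less_le scaleR_nonneg_nonneg)
  have fdisj: "inf (f a) (f b) = 0" if "a \<in> D" "b \<in> D" "a \<noteq> b" for a b
    using D that c(1) pos unfolding f_def
    by (intro disjoint_scaleR) (auto simp: disjoint_positive_def pairwise_def less_imp_le)
  have "inj_on f D"
  proof (rule inj_onI, rule ccontr)
    fix a b assume "a \<in> D" "b \<in> D" "f a = f b" "a \<noteq> b"
    then show False using fdisj[of a b] fpos[of b] by simp
  qed
  then have inf: "infinite (f ` D)" using \<open>infinite D\<close> finite_imageD by blast
  let ?F = "inf cofinite (principal (f ` D))"
  have ev: "eventually P ?F \<longleftrightarrow> finite {d\<in>f ` D. \<not> P d}" for P
    by (simp add: eventually_inf_principal eventually_cofinite)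
  have "?F \<noteq> bot" using inf by (auto simp: trivial_limit_def ev)
  moreover have "order_null ?F"
    using inf fpos fdisj c(2)
    by (intro bounded_disjoint_order_null[of _ e])
      (auto simp: disjoint_positive_def pairwise_def f_def)
  ultimately have "?F \<le> nhds 0" using agree by blast
  moreover have "((\<lambda>w. w + w) \<longlongrightarrow> 0) (nhds (0::'a))"
    using tendsto_add[of "\<lambda>w. w" "0::'a" "nhds 0" "\<lambda>w. w" 0] by (simp add: filterlim_ident)
  then have "\<forall>\<^sub>F w in nhds (0::'a). \<bar>w + w\<bar> \<le> e" using e by (auto simp: filterlim_iff)
  ultimately have "\<forall>\<^sub>F w in ?F. \<bar>w + w\<bar> \<le> e" by (auto simp: le_filter_def)
  moreover have "{w\<in>f ` D. \<not> \<not> \<bar>w + w\<bar> \<le> e} = {}"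
    using c(3) unfolding f_def by (blast intro: order_trans[OF abs_ge_self])
  then have "\<forall>\<^sub>F w in ?F. \<not> \<bar>w + w\<bar> \<le> e" by (simp only: ev finite.emptyI)
  ultimately have "eventually (\<lambda>_. False) ?F" by eventually_elim blast
  with \<open>?F \<noteq> bot\<close> show False by (simp add: trivial_limit_def)
qed

section \<open>Finite-dimensional topological vector lattices\<close>

text \<open>Both sides are compared with the condition \<open>?eps\<close> that \<open>\<bar>w\<bar> \<le> \<epsilon> *\<^sub>R e\<close> holds eventually
  for each \<open>\<epsilon> > 0\<close>. By \<open>bound\<close> it suffices to eventually avoid \<open>\<epsilon> *\<^sub>R a \<le> \<bar>w\<bar>\<close> for each of the
  finitely many atoms \<open>a\<close>. Topologically this holds since a solid neighbourhood that misses
  \<open>\<epsilon> *\<^sub>R a\<close> contains no such \<open>w\<close>; in the order sense, since the positive element \<open>\<epsilon> *\<^sub>R a\<close> is not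
  below all eventual bounds. Conversely, \<open>?eps\<close> implies order convergence by the Archimedean property
  and topological convergence because solid neighbourhoods contain small multiples of \<open>e\<close>.\<close>
lemma filters_agree_if_finite_disjoint:
  fixes F :: "'a::topological_vector_lattice filter"
  assumes fin: "\<And>D::'a set. disjoint_positive D \<Longrightarrow> finite D"
  shows "F \<le> nhds 0 \<longleftrightarrow> order_null F"
proof -
  obtain G :: "'a set" where G: "finite G" "disjoint_positive G"
    and expand: "\<And>x. 0 \<le> x \<Longrightarrow> \<exists>t. (\<forall>a\<in>G. 0 \<le> t a) \<and> x = (\<Sum>a\<in>G. t a *\<^sub>R a)"
    using finite_atomic_frame[OF fin] by blast
  have pos: "0 < a" if "a \<in> G" for a using G(2) that by (simp add: disjoint_positive_def)
  define e where "e = \<Sum>G"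
  have "0 \<le> e" using pos unfolding e_def by (intro sum_nonneg) (simp add: less_imp_le)
  have bound: "x \<le> \<epsilon> *\<^sub>R e" if x: "0 \<le> x" and no: "\<forall>a\<in>G. \<not> \<epsilon> *\<^sub>R a \<le> x" for x \<epsilon>
  proof -
    obtain t where t: "\<And>a. a \<in> G \<Longrightarrow> 0 \<le> t a" and xt: "x = (\<Sum>a\<in>G. t a *\<^sub>R a)"
      using expand[OF x] by blast
    have "t a *\<^sub>R a \<le> \<epsilon> *\<^sub>R a" if a: "a \<in> G" for a
    proof -
      have "t a *\<^sub>R a \<le> x"
        unfolding xt using G(1) t pos a
        sum_mono2[of G "{a}" "\<lambda>a. t a *\<^sub>R a"]
        by (simp add: scaleR_nonneg_nonneg less_imp_le)
      then have "\<not> \<epsilon> \<le> t a"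
        using no a order_trans[OF scaleR_right_mono[of \<epsilon> "t a" a, OF _ less_imp_le[OF pos[OF a]]]]
        by blast
      then show ?thesis using pos[OF a] by (intro scaleR_right_mono) auto
    qed
    then show ?thesis unfolding xt e_def scaleR_sum_right by (rule sum_mono)
  qed
  have small: "\<forall>\<^sub>F w in H. \<bar>w\<bar> \<le> \<epsilon> *\<^sub>R e"
    if "\<And>a. a \<in> G \<Longrightarrow> \<forall>\<^sub>F w in H. \<not> \<epsilon> *\<^sub>R a \<le> \<bar>w\<bar>" for H \<epsilon>
  proof -
    have "\<forall>\<^sub>F w in H. \<forall>a\<in>G. \<not> \<epsilon> *\<^sub>R a \<le> \<bar>w\<bar>"
      using that G(1) by (simp add: eventually_ball_finite)
    then show ?thesis by eventually_elim (simp add: bound)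
  qed
  have not_le_0: "\<not> \<epsilon> *\<^sub>R a \<le> 0" if "0 < \<epsilon>" "a \<in> G" for \<epsilon> a
    using that pos[of a] scaleR_nonneg_nonneg[of \<epsilon> a] by (auto simp: order_le_less)
  have nbhd: "\<forall>\<^sub>F w in nhds 0. \<not> b \<le> \<bar>w\<bar>" if "0 < b" for b :: 'a
  proof -
    obtain U where U: "open U" "0 \<in> U" "b \<notin> U" using t1_space[of 0 b] \<open>0 < b\<close> by auto
    then obtain S where S: "S \<subseteq> U" "solid S" "\<forall>\<^sub>F z in nhds 0. z \<in> S" using solid_base by blast
    have "\<not> b \<le> \<bar>w\<bar>" if "w \<in> S" for w
    proof
      assume "b \<le> \<bar>w\<bar>"
      then have "\<bar>b\<bar> \<le> \<bar>w\<bar>" using \<open>0 < b\<close> by (simp only: abs_of_pos)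
      then show False using that S(1,2) U(3) unfolding solid_def by blast
    qed
    with S(3) show ?thesis by (auto elim: eventually_mono)
  qed
  have "(\<forall>\<epsilon>>0. \<forall>\<^sub>F w in F. \<bar>w\<bar> \<le> \<epsilon> *\<^sub>R e)" (is ?eps) if "F \<le> nhds 0"
  proof (intro allI impI small)
    fix \<epsilon> :: real and a assume "0 < \<epsilon>" "a \<in> G"
    then have "0 < \<epsilon> *\<^sub>R a"
      using not_le_0[of \<epsilon> a] pos[of a] scaleR_nonneg_nonneg[of \<epsilon> a] by (auto simp: order_le_less)
    from filter_leD[OF that nbhd[OF this]] show "\<forall>\<^sub>F w in F. \<not> \<epsilon> *\<^sub>R a \<le> \<bar>w\<bar>" .
  qed
  moreover have "order_null F" if ?eps
    unfolding order_null_def using that le_zero_if_le_small_multiples[OF \<open>0 \<le> e\<close>] by blast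
  moreover have ?eps if null: "order_null F"
  proof (intro allI impI small)
    fix \<epsilon> :: real and a assume "0 < \<epsilon>" "a \<in> G"
    then obtain v where "\<forall>\<^sub>F w in F. \<bar>w\<bar> \<le> v" "\<not> \<epsilon> *\<^sub>R a \<le> v"
      using null not_le_0 unfolding order_null_def by blast
    then show "\<forall>\<^sub>F w in F. \<not> \<epsilon> *\<^sub>R a \<le> \<bar>w\<bar>"
      by (auto elim!: eventually_mono intro: order_trans)
  qed
  moreover have "F \<le> nhds 0" if ?eps
    unfolding le_filter_def
  proof (intro allI impI)
    fix P :: "'a \<Rightarrow> bool" assume "eventually P (nhds 0)"
    then obtain U where U: "open U" "0 \<in> U" "\<forall>u\<in>U. P u" by (auto simp: eventually_nhds)
    then obtain S where S: "S \<subseteq> U" "solid S" "\<forall>\<^sub>F z in nhds 0. z \<in> S" using solid_base by blast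
    obtain \<epsilon> where \<epsilon>: "0 < \<epsilon>" "\<epsilon> *\<^sub>R e \<in> S" using small_multiple[OF S(3)] by blast
    have "\<forall>\<^sub>F w in F. \<bar>w\<bar> \<le> \<epsilon> *\<^sub>R e" using that \<epsilon>(1) by blast
    then show "eventually P F"
    proof eventually_elim
      case (elim w)
      then have "\<bar>w\<bar> \<le> \<bar>\<epsilon> *\<^sub>R e\<bar>" using abs_ge_self order_trans by blast
      then show "P w" using S(1,2) \<epsilon>(2) U(3) unfolding solid_def by blast
    qed
  qed
  ultimately show ?thesis by blast
qed

theorem theorem1:
  shows "(\<exists>B::'a::topological_vector_lattice set. finite B \<and> independent B \<and> span B = UNIV) \<longleftrightarrow>
    (\<forall>(A::('u, 'a) net_index set) r (x::('u, 'a) net_index \<Rightarrow> 'a). directed_set A r \<longrightarrow>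
      ((x \<longlongrightarrow> 0) (tails A r) \<longleftrightarrow> order_convergent A r x 0))"
  unfolding nets_iff_filters finite_dimensional_iff_finite_disjoint
  using finite_disjoint_if_filters_agree filters_agree_if_finite_disjoint by blast

end
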